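(* Let $\omega$ be a non-degenerate skew-symmetric bilinear form on $\mathbb{R}^{2n}$, and let $\nabla,\nabla'$ be two affine structures on $\mathbb{R}^{2n}$, both compatible with $\omega$, satisfying $\nabla_x\nabla'_y=\nabla_y\nabla'_x$ for all $x,y\in\mathbb{R}^{2n}$. Let $N_{\nabla,\nabla'}$ be the associated nilpotent Lie group with Lie algebra $\mathfrak{n}_{\nabla,\nabla'}=\mathbb{R}^{2n}\oplus\mathbb{R}^{2n}$. Define on $\mathfrak{n}_{\nabla,\nabla'}$ $$J(x,x')=(-x',x),\qquad E(x,x')=(x,-x'),\qquad g((x,x'),(y,y'))=-\omega(x,y')+\omega(x',y),$$ and extend $J,E,g$ to $N_{\nabla,\nabla'}$ by left translations. Then $\{J,E,g\}$ is a left-invariant hypersymplectic structure on $N_{\nabla,\nabla'}$.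
   Context: An affine structure on $\mathbb{R}^m$ is a bilinear map $\nabla:\mathbb{R}^m\times\mathbb{R}^m\to\mathbb{R}^m$, $(x,y)\mapsto\nabla_xy$, such that $\nabla_xy=\nabla_yx$ and $\nabla_x\nabla_y=\nabla_y\nabla_x$ (as endomorphisms of $\mathbb{R}^m$) for all $x,y\in\mathbb{R}^m$. It is compatible with a non-degenerate skew-symmetric bilinear form $\omega$ on $\mathbb{R}^m$ if $\omega(\nabla_xy,z)=\omega(\nabla_xz,y)$ for all $x,y,z\in\mathbb{R}^m$. Given $\omega,\nabla,\nabla'$ as in the claim, $N_{\nabla,\nabla'}$ is the manifold $\mathbb{R}^{4n}=\mathbb{R}^{2n}\times\mathbb{R}^{2n}$ with the product $$(x,x')\cdot(y,y')=\bigl(x+y+\nabla'_yx'-\tfrac12\nabla'_y\nabla_yx',\ x'-\nabla_{x'}y-\tfrac12\nabla_{x'}\nabla'_{x'}y+y'\bigr).$$ It is a nilpotent Lie group with neutral element $(0,0)$, and its Lie algebra $\mathfrak{n}_{\nabla,\nabla'}$ is $\mathbb{R}^{2n}\oplus\mathbb{R}^{2n}$ with bracket $[(x,x'),(y,y')]=(\nabla'_yx'-\nabla'_xy',\ \nabla_xy'-\nabla_yx')$. A hypersymplectic structure on a $4n$-dimensional manifold $M$ is a triple $(J,E,g)$ where $J,E$ are endomorphisms of the tangent bundle of $M$ with $J^2=-\mathrm{Id}$, $E^2=\mathrm{Id}$, $JE=-EJ$; $g$ is a pseudo-Riemannian metric of signature $(2n,2n)$ satisfying $g(X,Y)=g(JX,JY)=-g(EX,EY)$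 for all vector fields $X,Y$ on $M$; and the $2$-forms $\omega_1(X,Y)=g(JX,Y)$, $\omega_2(X,Y)=g(EX,Y)$, $\omega_3(X,Y)=g(JEX,Y)$ are closed. *)

theory Defs
  imports "HOL-Analysis.Analysis" "HOL-Algebra.Group"
begin

section \<open>Affine structures and the group they define\<close>

definition affine_structure :: "('a::real_vector \<Rightarrow> 'a \<Rightarrow> 'a) \<Rightarrow> bool" where
  "affine_structure D \<longleftrightarrow>
     bilinear D \<and> (\<forall>x y. D x y = D y x) \<and> (\<forall>x y. D x \<circ> D y = D y \<circ> D x)"

definition nondegenerate_skew_form :: "('a::real_vector \<Rightarrow> 'a \<Rightarrow> real) \<Rightarrow> bool" where
  "nondegenerate_skew_form \<omega> \<longleftrightarrow>
     bilinear \<omega> \<and> (\<forall>x y. \<omega> x y = - \<omega> y x) \<and> (\<forall>x. (\<forall>y. \<omega> x y = 0) \<longrightarrow> x = 0)"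

definition compatible :: "('a::real_vector \<Rightarrow> 'a \<Rightarrow> real) \<Rightarrow> ('a \<Rightarrow> 'a \<Rightarrow> 'a) \<Rightarrow> bool" where
  "compatible \<omega> D \<longleftrightarrow> (\<forall>x y z. \<omega> (D x y) z = \<omega> (D x z) y)"

definition nil_mult ::
  "('a::real_vector \<Rightarrow> 'a \<Rightarrow> 'a) \<Rightarrow> ('a \<Rightarrow> 'a \<Rightarrow> 'a) \<Rightarrow> 'a \<times> 'a \<Rightarrow> 'a \<times> 'a \<Rightarrow> 'a \<times> 'a" where
  "nil_mult D D' = (\<lambda>(x, x') (y, y').
     (x + y + D' y x' - (1/2) *\<^sub>R D' y (D y x'),
      x' - D x' y - (1/2) *\<^sub>R D x' (D' x' y) + y'))"

definition nil_group ::
  "('a::real_vector \<Rightarrow> 'a \<Rightarrow> 'a) \<Rightarrow> ('a \<Rightarrow> 'a \<Rightarrow> 'a) \<Rightarrow> ('a \<times> 'a) monoid" where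
  "nil_group D D' = \<lparr>carrier = UNIV, mult = nil_mult D D', one = (0, 0)\<rparr>"

lemma compatible_affine_square_zero:
  assumes \<omega>: "nondegenerate_skew_form \<omega>" and D: "affine_structure D" "compatible \<omega> D"
  shows "D x (D y z) = 0"
proof -
  have skew: "\<omega> a b = - \<omega> b a" for a b
    using \<omega> unfolding nondegenerate_skew_form_def by blast
  have sym: "D a b = D b a" for a b
    using D unfolding affine_structure_def by blast
  have comm: "D a (D b c) = D b (D a c)" for a b c
    using D unfolding affine_structure_def by (metis comp_apply)
  have cp: "\<omega> (D a b) c = \<omega> (D a c) b" for a b c
    using D unfolding compatible_def by blast
  have 1: "\<omega> (D a (D b c)) d = - \<omega> (D a (D b d)) c" for a b c d
    by (metis comm cp skew)
  have 2: "\<omega> (D a (D b c)) d = \<omega> (D a (D c b)) d" for a b c d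
    by (simp add: sym)
  have "\<omega> (D x (D y z)) w = 0" for w
    using 1[of x y z w] 2[of x y w z] 1[of x w y z] 2[of x w z y] 1[of x z w y] 2[of x z y w]
    by linarith
  then show ?thesis
    using \<omega> unfolding nondegenerate_skew_form_def by blast
qed

lemma mixed_swap:
  assumes \<omega>: "nondegenerate_skew_form \<omega>"
    and D: "compatible \<omega> D" and D': "compatible \<omega> D'"
    and mix: "\<And>x y. D x \<circ> D' y = D y \<circ> D' x"
  shows "D' x (D y z) = D' y (D x z)"
proof -
  have skew: "\<omega> a b = - \<omega> b a" for a b
    using \<omega> unfolding nondegenerate_skew_form_def by blast
  have bil: "bilinear \<omega>"
    using \<omega> unfolding nondegenerate_skew_form_def by blast
  have adj: "\<omega> (D a b) c = - \<omega> b (D a c)" "\<omega> (D' a b) c = - \<omega> b (D' a c)" for a b c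
    using D D' skew unfolding compatible_def by metis+
  have m: "D a (D' b c) = D b (D' a c)" for a b c
    using mix by (metis comp_apply)
  have "\<omega> (D' x (D y z) - D' y (D x z)) w = 0" for w
    by (simp add: bilinear_lsub[OF bil] adj m[of x y])
  then have "D' x (D y z) - D' y (D x z) = 0"
    using \<omega> unfolding nondegenerate_skew_form_def by blast
  then show ?thesis by simp
qed

lemma group_nil_group:
  assumes \<omega>: "nondegenerate_skew_form \<omega>"
    and D: "affine_structure D" "compatible \<omega> D"
    and D': "affine_structure D'" "compatible \<omega> D'"
    and mix: "\<forall>x y. D x \<circ> D' y = D y \<circ> D' x"
  shows "group (nil_group D D')"
proof -
  have bD: "bilinear D" and bD': "bilinear D'"
    using D D' unfolding affine_structure_def by auto
  have s: "D a b = D b a" and s': "D' a b = D' b a" for a b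
    using D D' unfolding affine_structure_def by auto
  have z [simp]: "D a (D b c) = 0" "D' a (D' b c) = 0" for a b c
    using compatible_affine_square_zero \<omega> D D' by blast+
  have z1 [simp]: "D (D b c) a = 0" "D' (D' b c) a = 0" for a b c
    using s s' z by metis+
  have m: "D a (D' b c) = D b (D' a c)" for a b c
    using mix by (metis comp_apply)
  have m': "D' a (D b c) = D' b (D a c)" for a b c
    using mixed_swap[OF \<omega> D(2) D'(2)] mix by blast
  have t [simp]: "D' c (D d (D' e f)) = 0" "D c (D' d (D e f)) = 0" for c d e f
    using m m' s s' z by metis+
  have t1 [simp]: "D' c (D (D' e f) d) = 0" "D c (D' (D e f) d) = 0"
     "D' (D d (D' e f)) c = 0" "D' (D (D' e f) d) c = 0"
     "D (D' d (D e f)) c = 0" "D (D' (D e f) d) c = 0"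
     "D' (D' e f) d = 0" "D (D e f) d = 0"
     "D' (D' e f) (D c d) = 0" "D (D e f) (D' c d) = 0" for c d e f
    using t s s' z by metis+
  note simps = bilinear_ladd[OF bD] bilinear_radd[OF bD] bilinear_ladd[OF bD']
    bilinear_radd[OF bD'] bilinear_lsub[OF bD] bilinear_rsub[OF bD] bilinear_lsub[OF bD']
    bilinear_rsub[OF bD'] bilinear_lmul[OF bD] bilinear_rmul[OF bD] bilinear_lmul[OF bD']
    bilinear_rmul[OF bD'] bilinear_lneg[OF bD] bilinear_rneg[OF bD] bilinear_lneg[OF bD']
    bilinear_rneg[OF bD'] bilinear_lzero[OF bD] bilinear_rzero[OF bD] bilinear_lzero[OF bD']
    bilinear_rzero[OF bD'] scaleR_add_right scaleR_diff_right
  have [simp]: "(1/2::real) *\<^sub>R v + (1/2) *\<^sub>R v = v" for v :: 'a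
    by (simp flip: scaleR_add_left)
  have half: "v = (1/2::real) *\<^sub>R v + (1/2) *\<^sub>R v" for v :: 'a
    by simp
  have assoc: "nil_mult D D' (nil_mult D D' p q) r = nil_mult D D' p (nil_mult D D' q r)" for p q r
  proof -
    obtain x x' y y' w w' where p: "p = (x, x')" "q = (y, y')" "r = (w, w')"
      by (metis surj_pair)
    have A: "D' y (D w x') = D' w (D x' y)" "D' w (D y x') = D' w (D x' y)"
      using m' s by metis+
    have B: "D y' (D' x' w) = D x' (D' w y')" "D x' (D' y' w) = D x' (D' w y')"
      using m s' by metis+
    show ?thesis
      unfolding p nil_mult_def
      using half[of "D' w (D x' y)"] half[of "D x' (D' w y')"]
      by (simp add: simps A B algebra_simps)
  qed
  have one: "nil_mult D D' (0, 0) p = p" for p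
    by (cases p) (simp add: nil_mult_def simps)
  have inv: "\<exists>q. nil_mult D D' q p = (0, 0)" for p
  proof -
    have right: "\<exists>q. nil_mult D D' p q = (0, 0)" for p
    proof -
      obtain x x' where p: "p = (x, x')" by fastforce
      define y where "y = - x + D' x x' + (1/2) *\<^sub>R D' x (D x x')"
      have "D' x' (D x x') = D' x (D x' x')" by (rule m')
      then have "nil_mult D D' p (y, - x' + D x' y + (1/2) *\<^sub>R D x' (D' x' y)) = (0, 0)"
        by (simp add: p nil_mult_def y_def simps s'[of _ x'] algebra_simps)
      then show ?thesis by blast
    qed
    have rone: "nil_mult D D' p (0, 0) = p" for p
      by (cases p) (simp add: nil_mult_def simps)
    obtain q where q: "nil_mult D D' p q = (0, 0)" using right by blast
    obtain r where r: "nil_mult D D' q r = (0, 0)" using right by blast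
    have "r = p" using assoc[of p q r] q r one rone by metis
    then show ?thesis using r by blast
  qed
  show ?thesis
    by (rule groupI) (simp_all add: nil_group_def assoc one inv del: split_paired_Ex)
qed


section \<open>Tensor fields on a Euclidean space\<close>

text \<open>
  The manifold is a whole Euclidean space \<open>'a\<close>, and the tangent space at each point is identified
  with \<open>'a\<close> by the global chart. An endomorphism of the tangent bundle is thus a function
  \<open>J :: 'a \<Rightarrow> 'a \<Rightarrow> 'a\<close> and a field of bilinear forms a function \<open>g :: 'a \<Rightarrow> 'a \<Rightarrow> 'a \<Rightarrow> real\<close>, the
  first argument being the base point. Identities between tensor fields are stated at each
  point for all tangent vectors.
\<close>

fun Ck :: "nat \<Rightarrow> ('a::euclidean_space \<Rightarrow> 'b::real_normed_vector) \<Rightarrow> bool" where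
  "Ck 0 f \<longleftrightarrow> continuous_on UNIV f"
| "Ck (Suc k) f \<longleftrightarrow>
     f differentiable_on UNIV \<and> (\<forall>v. Ck k (\<lambda>p. frechet_derivative f (at p) v))"

definition smooth_map :: "('a::euclidean_space \<Rightarrow> 'b::real_normed_vector) \<Rightarrow> bool" where
  "smooth_map f \<longleftrightarrow> (\<forall>k. Ck k f)"

definition tangent_endomorphism :: "('a::euclidean_space \<Rightarrow> 'a \<Rightarrow> 'a) \<Rightarrow> bool" where
  "tangent_endomorphism J \<longleftrightarrow> (\<forall>p. linear (J p)) \<and> (\<forall>v. smooth_map (\<lambda>p. J p v))"

definition bilinear_field :: "('a::euclidean_space \<Rightarrow> 'a \<Rightarrow> 'a \<Rightarrow> real) \<Rightarrow> bool" where
  "bilinear_field g \<longleftrightarrow> (\<forall>p. bilinear (g p)) \<and> (\<forall>u v. smooth_map (\<lambda>p. g p u v))"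

text \<open>The existence of a basis that is orthonormal up to signs, with \<open>r\<close> plus and \<open>s\<close> minus
  signs; for a symmetric form this includes non-degeneracy.\<close>

definition has_signature :: "('a::euclidean_space \<Rightarrow> 'a \<Rightarrow> real) \<Rightarrow> nat \<Rightarrow> nat \<Rightarrow> bool" where
  "has_signature B r s \<longleftrightarrow>
     r + s = DIM('a) \<and>
     (\<exists>e :: nat \<Rightarrow> 'a. span (e ` {..<r + s}) = UNIV \<and>
        (\<forall>i<r + s. \<forall>j<r + s. B (e i) (e j) = (if i \<noteq> j then 0 else if i < r then 1 else - 1)))"

definition pseudo_riemannian_metric ::
  "nat \<Rightarrow> nat \<Rightarrow> ('a::euclidean_space \<Rightarrow> 'a \<Rightarrow> 'a \<Rightarrow> real) \<Rightarrow> bool" where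
  "pseudo_riemannian_metric r s g \<longleftrightarrow>
     bilinear_field g \<and> (\<forall>p u v. g p u v = g p v u) \<and> (\<forall>p. has_signature (g p) r s)"

definition two_form :: "('a::euclidean_space \<Rightarrow> 'a \<Rightarrow> 'a \<Rightarrow> real) \<Rightarrow> bool" where
  "two_form \<alpha> \<longleftrightarrow> bilinear_field \<alpha> \<and> (\<forall>p u v. \<alpha> p u v = - \<alpha> p v u)"

text \<open>The invariant formula for the exterior derivative, evaluated on the constant vector fields
  \<open>u\<close>, \<open>v\<close>, \<open>w\<close>, whose Lie brackets vanish.\<close>

definition exterior_derivative ::
  "('a::euclidean_space \<Rightarrow> 'a \<Rightarrow> 'a \<Rightarrow> real) \<Rightarrow> 'a \<Rightarrow> 'a \<Rightarrow> 'a \<Rightarrow> 'a \<Rightarrow> real" where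
  "exterior_derivative \<alpha> p u v w =
     frechet_derivative (\<lambda>q. \<alpha> q v w) (at p) u
   - frechet_derivative (\<lambda>q. \<alpha> q u w) (at p) v
   + frechet_derivative (\<lambda>q. \<alpha> q u v) (at p) w"

definition closed_two_form :: "('a::euclidean_space \<Rightarrow> 'a \<Rightarrow> 'a \<Rightarrow> real) \<Rightarrow> bool" where
  "closed_two_form \<alpha> \<longleftrightarrow> two_form \<alpha> \<and> (\<forall>p u v w. exterior_derivative \<alpha> p u v w = 0)"

definition hypersymplectic ::
  "nat \<Rightarrow> ('a::euclidean_space \<Rightarrow> 'a \<Rightarrow> 'a) \<Rightarrow> ('a \<Rightarrow> 'a \<Rightarrow> 'a) \<Rightarrow> ('a \<Rightarrow> 'a \<Rightarrow> 'a \<Rightarrow> real) \<Rightarrow> bool" where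
  "hypersymplectic n J E g \<longleftrightarrow>
     DIM('a) = 4 * n \<and>
     tangent_endomorphism J \<and> tangent_endomorphism E \<and>
     (\<forall>p v. J p (J p v) = - v) \<and>
     (\<forall>p v. E p (E p v) = v) \<and>
     (\<forall>p v. J p (E p v) = - E p (J p v)) \<and>
     pseudo_riemannian_metric (2 * n) (2 * n) g \<and>
     (\<forall>p u v. g p u v = g p (J p u) (J p v)) \<and>
     (\<forall>p u v. g p u v = - g p (E p u) (E p v)) \<and>
     closed_two_form (\<lambda>p u v. g p (J p u) v) \<and>
     closed_two_form (\<lambda>p u v. g p (E p u) v) \<and>
     closed_two_form (\<lambda>p u v. g p (J p (E p u)) v)"


section \<open>Left translations\<close>

text \<open>Here \<open>G\<close> is a Lie group whose underlying manifold is the whole Euclidean space \<open>'a\<close>.\<close>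

definition d_left :: "('a::euclidean_space) monoid \<Rightarrow> 'a \<Rightarrow> 'a \<Rightarrow> 'a \<Rightarrow> 'a" where
  "d_left G p q = frechet_derivative (\<lambda>r. p \<otimes>\<^bsub>G\<^esub> r) (at q)"

text \<open>The fields that agree with a given tensor on the Lie algebra, i.e. the tangent space at the
  neutral element, and are transported by left translations. The differential
  \<open>d_left G p \<one>\<^bsub>G\<^esub>\<close> is an isomorphism from there onto the tangent space at \<open>p\<close>.\<close>

definition left_extend_endo ::
  "('a::euclidean_space) monoid \<Rightarrow> ('a \<Rightarrow> 'a) \<Rightarrow> 'a \<Rightarrow> 'a \<Rightarrow> 'a" where
  "left_extend_endo G J p v = d_left G p \<one>\<^bsub>G\<^esub> (J (inv_into UNIV (d_left G p \<one>\<^bsub>G\<^esub>) v))"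

definition left_extend_form ::
  "('a::euclidean_space) monoid \<Rightarrow> ('a \<Rightarrow> 'a \<Rightarrow> real) \<Rightarrow> 'a \<Rightarrow> 'a \<Rightarrow> 'a \<Rightarrow> real" where
  "left_extend_form G g p u v =
     g (inv_into UNIV (d_left G p \<one>\<^bsub>G\<^esub>) u) (inv_into UNIV (d_left G p \<one>\<^bsub>G\<^esub>) v)"

definition left_invariant_endo ::
  "('a::euclidean_space) monoid \<Rightarrow> ('a \<Rightarrow> 'a \<Rightarrow> 'a) \<Rightarrow> bool" where
  "left_invariant_endo G J \<longleftrightarrow>
     (\<forall>p q v. J (p \<otimes>\<^bsub>G\<^esub> q) (d_left G p q v) = d_left G p q (J q v))"

definition left_invariant_form ::
  "('a::euclidean_space) monoid \<Rightarrow> ('a \<Rightarrow> 'a \<Rightarrow> 'a \<Rightarrow> real) \<Rightarrow> bool" where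
  "left_invariant_form G g \<longleftrightarrow>
     (\<forall>p q u v. g (p \<otimes>\<^bsub>G\<^esub> q) (d_left G p q u) (d_left G p q v) = g q u v)"

definition left_invariant_hypersymplectic ::
  "nat \<Rightarrow> ('a::euclidean_space) monoid \<Rightarrow>
     ('a \<Rightarrow> 'a \<Rightarrow> 'a) \<Rightarrow> ('a \<Rightarrow> 'a \<Rightarrow> 'a) \<Rightarrow> ('a \<Rightarrow> 'a \<Rightarrow> 'a \<Rightarrow> real) \<Rightarrow> bool" where
  "left_invariant_hypersymplectic n G J E g \<longleftrightarrow>
     hypersymplectic n J E g \<and>
     left_invariant_endo G J \<and> left_invariant_endo G E \<and> left_invariant_form G g"


section \<open>The structure on the Lie algebra\<close>

definition J0 :: "'a::real_vector \<times> 'a \<Rightarrow> 'a \<times> 'a" where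
  "J0 = (\<lambda>(x, x'). (- x', x))"

definition E0 :: "'a::real_vector \<times> 'a \<Rightarrow> 'a \<times> 'a" where
  "E0 = (\<lambda>(x, x'). (x, - x'))"

definition g0 :: "('a::real_vector \<Rightarrow> 'a \<Rightarrow> real) \<Rightarrow> 'a \<times> 'a \<Rightarrow> 'a \<times> 'a \<Rightarrow> real" where
  "g0 \<omega> = (\<lambda>(x, x') (y, y'). - \<omega> x y' + \<omega> x' y)"

end

theory Submission
  imports Defs
begin

text \<open>
  The differential at the neutral element of the left translation by \<open>p = (x, x')\<close> is
  \<open>(u, u') \<mapsto> (u + P u, u' - Q u - 1/2 Q P u)\<close> with \<open>P = D' x'\<close> and \<open>Q = D x'\<close>. As
  \<open>P\<close> and \<open>Q\<close> have square zero, its inverse is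
  \<open>B (v, v') = (v - P v, v' + Q v - 1/2 Q P v)\<close>. So the extended tensors are polynomial in the
  base point, and the pointwise identities and the signature follow by transport from the Lie
  algebra. The signature there is visible in the basis \<open>(b, - f/2), (b, f/2)\<close>, where \<open>b\<close>
  runs over a basis and \<open>f\<close> over the basis that is dual to it under \<open>\<omega>\<close>. Left invariance is
  the chain rule combined with associativity of the group.

  For the closed forms, write \<open>\<alpha>\<close> and \<open>\<beta>\<close> for \<open>\<omega>\<close> applied to the first and to the
  second components of \<open>B v\<close> and \<open>B w\<close>. The first and the third fundamental form are
  \<open>\<alpha> + \<beta>\<close> and \<open>\<alpha> - \<beta>\<close>. The endomorphisms \<open>P\<close> and \<open>Q\<close> are skew for \<open>\<omega>\<close>, and the
  form \<open>\<omega> (D a (D' b c)) d\<close> is symmetric in all four arguments, so \<open>P Q = - Q P\<close>. With these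
  rules \<open>\<alpha>\<close> is constant, while \<open>\<beta>\<close> and the second fundamental form are each a constant
  form plus \<open>h x' v w' - h x' w v'\<close> for some \<open>h\<close> whose derivative \<open>h' y t a b\<close> is symmetric
  in \<open>t\<close> and \<open>b\<close>. Such a form is closed (\<open>closed_two_form_mixed\<close>): it wedges the constant
  one-forms of the first factor with closed one-forms of the second.
\<close>

section \<open>Smooth maps\<close>

lemma Ck_const: "Ck k (\<lambda>p. c)"
  by (induction k arbitrary: c) auto

lemma Ck_SucD: "Ck (Suc k) f \<Longrightarrow> Ck k f"
  by (induction k arbitrary: f) (auto intro: differentiable_imp_continuous_on)

lemma Ck_linear:
  assumes "linear f"
  shows "Ck k f"
proof (cases k)
  case 0
  then show ?thesis using assms by (simp add: linear_continuous_on linear_linear)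
next
  case (Suc j)
  have f: "(f has_derivative f) (at p)" for p
    using assms by (simp add: linear_linear bounded_linear_imp_has_derivative)
  have "(\<lambda>p. frechet_derivative f (at p) v) = (\<lambda>p. f v)" for v
    using frechet_derivative_at[OF f] by metis
  moreover have "f differentiable_on UNIV"
    using f by (auto simp: differentiable_on_def differentiable_def)
  ultimately show ?thesis using Suc by (simp add: Ck_const)
qed

lemma Ck_add:
  assumes "Ck k f" "Ck k g"
  shows "Ck k (\<lambda>p. f p + g p)"
  using assms
proof (induction k arbitrary: f g)
  case 0
  then show ?case by (auto intro: continuous_intros)
next
  case (Suc k)
  then have f: "(f has_derivative frechet_derivative f (at p)) (at p)"
    and g: "(g has_derivative frechet_derivative g (at p)) (at p)" for p
    by (auto simp: differentiable_on_def frechet_derivative_works)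
  have "(\<lambda>p. frechet_derivative (\<lambda>p. f p + g p) (at p) v)
      = (\<lambda>p. frechet_derivative f (at p) v + frechet_derivative g (at p) v)" for v
    using frechet_derivative_at[OF has_derivative_add[OF f g]] by metis
  then show ?case using Suc by (auto intro: differentiable_on_add)
qed

text \<open>The product rule expresses the derivative of a product by products of maps one degree
  less regular, so regularity passes to products by induction on the order.\<close>

lemma Ck_bilinear:
  assumes h: "bounded_bilinear h" and "Ck k f" "Ck k g"
  shows "Ck k (\<lambda>p. h (f p) (g p))"
  using assms(2,3)
proof (induction k arbitrary: f g)
  case 0
  then show ?case by (auto intro: bounded_bilinear.continuous_on[OF h])
next
  case (Suc k)
  then have f: "(f has_derivative frechet_derivative f (at p)) (at p)"
    and g: "(g has_derivative frechet_derivative g (at p)) (at p)" for p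
    by (auto simp: differentiable_on_def frechet_derivative_works)
  note fg = bounded_bilinear.FDERIV[OF h f g]
  have "(\<lambda>p. frechet_derivative (\<lambda>p. h (f p) (g p)) (at p) v)
      = (\<lambda>p. h (f p) (frechet_derivative g (at p) v) + h (frechet_derivative f (at p) v) (g p))" for v
    using frechet_derivative_at[OF fg] by metis
  moreover have "(\<lambda>p. h (f p) (g p)) differentiable_on UNIV"
    using fg by (auto simp: differentiable_on_def differentiable_def)
  moreover have "Ck k f" "Ck k g"
    using Suc.prems Ck_SucD by blast+
  ultimately show ?case
    using Suc by (simp add: Ck_add)
qed

lemma smooth_map_const: "smooth_map (\<lambda>p. c)"
  by (simp add: smooth_map_def Ck_const)

lemma smooth_map_linear: "linear f \<Longrightarrow> smooth_map f"
  by (simp add: smooth_map_def Ck_linear)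

lemma smooth_map_add: "smooth_map f \<Longrightarrow> smooth_map g \<Longrightarrow> smooth_map (\<lambda>p. f p + g p)"
  by (simp add: smooth_map_def Ck_add)

lemma smooth_map_bilinear:
  "bounded_bilinear h \<Longrightarrow> smooth_map f \<Longrightarrow> smooth_map g \<Longrightarrow> smooth_map (\<lambda>p. h (f p) (g p))"
  by (simp add: smooth_map_def Ck_bilinear)

lemma smooth_map_compose_linear:
  assumes "bounded_linear h" "smooth_map f"
  shows "smooth_map (\<lambda>p. h (f p))"
proof -
  have "bounded_bilinear (\<lambda>(c::real) v. c *\<^sub>R h v)"
    using bounded_bilinear.comp[OF bounded_bilinear_scaleR bounded_linear_ident assms(1)] by simp
  from smooth_map_bilinear[OF this smooth_map_const[of 1] assms(2)] show ?thesis by simp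
qed

lemma smooth_map_scaleR: "smooth_map f \<Longrightarrow> smooth_map (\<lambda>p. c *\<^sub>R f p)"
  by (rule smooth_map_compose_linear[OF bounded_linear_scaleR_right])

lemma smooth_map_minus: "smooth_map f \<Longrightarrow> smooth_map (\<lambda>p. - f p)"
  using smooth_map_scaleR[of f "-1"] by simp

lemma smooth_map_diff: "smooth_map f \<Longrightarrow> smooth_map g \<Longrightarrow> smooth_map (\<lambda>p. f p - g p)"
  using smooth_map_add[OF _ smooth_map_minus, of f g] by simp

lemma smooth_map_Pair:
  assumes "smooth_map f" "smooth_map g"
  shows "smooth_map (\<lambda>p. (f p, g p))"
proof -
  have "smooth_map (\<lambda>p. (f p, 0) + (0, g p))"
    by (intro smooth_map_add smooth_map_compose_linear[of "\<lambda>a. (a, 0)"]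
        smooth_map_compose_linear[of "\<lambda>a. (0, a)"] assms bounded_linear_Pair
        bounded_linear_ident bounded_linear_zero)
  then show ?thesis by simp
qed

lemma smooth_map_snd: "smooth_map (snd :: 'a::euclidean_space \<times> 'b::euclidean_space \<Rightarrow> 'b)"
  by (intro smooth_map_linear bounded_linear.linear bounded_linear_snd)

lemmas smooth_map_intros = smooth_map_const smooth_map_add smooth_map_diff smooth_map_minus
  smooth_map_scaleR smooth_map_Pair smooth_map_snd


section \<open>Closed two-forms\<close>

text \<open>If for each \<open>a\<close> the one-form \<open>b \<mapsto> h y a b\<close> on the second factor is closed, that is,
  if its derivative is symmetric, then wedging with the constant one-forms of the first factor
  gives a closed two-form.\<close>

lemma closed_two_form_mixed:
  fixes k :: "'a::euclidean_space \<times> 'a \<Rightarrow> 'a \<times> 'a \<Rightarrow> real"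
    and h :: "'a \<Rightarrow> 'a \<Rightarrow> 'a \<Rightarrow> real"
  assumes k: "bilinear k" "\<And>u v. k u v = - k v u"
    and h: "\<And>y. bilinear (h y)"
    and smooth: "\<And>a b. smooth_map (\<lambda>p::'a \<times> 'a. h (snd p) a b)"
    and deriv: "\<And>y a b. ((\<lambda>y. h y a b) has_derivative (\<lambda>t. h' y t a b)) (at y)"
    and sym: "\<And>y t a b. h' y t a b = h' y b a t"
  shows "closed_two_form (\<lambda>p u v. k u v + h (snd p) (fst u) (snd v) - h (snd p) (fst v) (snd u))"
    (is "closed_two_form ?\<alpha>")
proof -
  have "((\<lambda>q. h (snd q) a b) has_derivative (\<lambda>t. h' (snd p) (snd t) a b)) (at p)"
    for p :: "'a \<times> 'a" and a b
    by (rule has_derivative_compose[OF has_derivative_snd[OF has_derivative_ident] deriv])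
  from has_derivative_diff[OF has_derivative_add[OF has_derivative_const this] this]
  have "((\<lambda>q. ?\<alpha> q u v) has_derivative (\<lambda>t. h' (snd p) (snd t) (fst u) (snd v)
      - h' (snd p) (snd t) (fst v) (snd u))) (at p)" for p u v
    by simp
  note d = frechet_derivative_at[OF this, symmetric]
  have "exterior_derivative ?\<alpha> p u v w = 0" for p u v w
    unfolding exterior_derivative_def d
    \<comment> \<open>the six terms of the cyclic sum cancel in pairs by \<open>sym\<close>\<close>
    using sym[of "snd p" "snd u" "fst v" "snd w"] sym[of "snd p" "snd u" "fst w" "snd v"]
      sym[of "snd p" "snd v" "fst u" "snd w"]
    by simp
  moreover have "bilinear (?\<alpha> p)" for p
    using k(1) h[of "snd p"] unfolding bilinear_def linear_iff by (simp add: algebra_simps)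
  moreover have "smooth_map (\<lambda>p. ?\<alpha> p u v)" for u v
    by (intro smooth_map_intros smooth)
  moreover have "?\<alpha> p u v = - ?\<alpha> p v u" for p u v
    using k(2)[of u v] by simp
  ultimately show ?thesis
    unfolding closed_two_form_def two_form_def bilinear_field_def by blast
qed


section \<open>The signature of the metric on the Lie algebra\<close>

lemma has_signature_linear_iso:
  fixes A A' :: "'a::euclidean_space \<Rightarrow> 'a"
  assumes B: "has_signature B r s" and A: "linear A" and surj: "\<And>v. A (A' v) = v"
    and inj: "\<And>v. A' (A v) = v"
  shows "has_signature (\<lambda>u v. B (A' u) (A' v)) r s"
proof -
  obtain e :: "nat \<Rightarrow> 'a" where e: "span (e ` {..<r + s}) = UNIV"
    "\<forall>i<r + s. \<forall>j<r + s. B (e i) (e j) = (if i \<noteq> j then 0 else if i < r then 1 else - 1)"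
    and rs: "r + s = DIM('a)"
    using B unfolding has_signature_def by blast
  have "span ((A \<circ> e) ` {..<r + s}) = A ` span (e ` {..<r + s})"
    by (simp add: linear_span_image[OF A] flip: image_image)
  also have "\<dots> = UNIV"
    unfolding e by (metis surj surjI)
  finally show ?thesis
    unfolding has_signature_def using rs e(2) inj by (intro conjI exI[of _ "A \<circ> e"]) auto
qed

text \<open>A basis that is dual to the standard one with respect to \<open>\<omega>\<close>.\<close>

lemma dual_basis:
  fixes \<omega> :: "'a::euclidean_space \<Rightarrow> 'a \<Rightarrow> real"
  assumes \<omega>: "nondegenerate_skew_form \<omega>"
  obtains f :: "'a \<Rightarrow> 'a" where "span (f ` Basis) = UNIV"
    "\<And>b c. b \<in> Basis \<Longrightarrow> c \<in> Basis \<Longrightarrow> \<omega> b (f c) = (if b = c then 1 else 0)"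
proof -
  have bil: "bilinear \<omega>" and skew: "\<And>x y. \<omega> x y = - \<omega> y x"
    and nd: "\<And>x. (\<And>y. \<omega> x y = 0) \<Longrightarrow> x = 0"
    using \<omega> unfolding nondegenerate_skew_form_def by blast+
  define T where "T y = (\<Sum>b\<in>Basis. \<omega> b y *\<^sub>R b)" for y
  have T_inner: "T y \<bullet> b = \<omega> b y" if "b \<in> Basis" for y b
    using that by (simp add: T_def inner_sum_left inner_Basis if_distrib sum.If_cases
        cong: if_cong)
  have lin: "linear T"
    by (rule linearI)
      (simp_all add: T_def bilinear_radd[OF bil] bilinear_rmul[OF bil] scaleR_add_left
        sum.distrib scaleR_sum_right)
  have "inj T"
  proof (subst linear_injective_0[OF lin], intro allI impI)
    fix y assume "T y = 0"
    then have 0: "\<omega> b y = 0" if "b \<in> Basis" for b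
      using T_inner[OF that, of y] by simp
    have "linear (\<lambda>x. \<omega> x y)" using bil by (simp add: bilinear_def)
    from linear_eq_0_on_span[OF this, of Basis] 0 have "\<omega> x y = 0" for x
      by simp
    then show "y = 0" using nd skew by (metis minus_zero)
  qed
  then have "surj T" using lin linear_injective_imp_surjective by blast
  then obtain f where f: "linear f" "T \<circ> f = id" "f \<circ> T = id"
    by (metis \<open>inj T\<close> lin linear_injective_isomorphism comp_def eq_id_iff)
  show thesis
  proof
    have "span (f ` Basis) = f ` UNIV" by (simp add: linear_span_image[OF f(1)])
    also have "\<dots> = UNIV" by (metis f(3) comp_apply id_apply surjI)
    finally show "span (f ` Basis) = UNIV" .
    have Tf: "T (f c) = c" for c by (metis f(2) comp_apply id_apply)
    show "\<omega> b (f c) = (if b = c then 1 else 0)" if "b \<in> Basis" "c \<in> Basis" for b c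
      using T_inner[OF that(1), of "f c"] that by (auto simp: Tf inner_Basis)
  qed
qed

text \<open>With \<open>f\<close> dual to the standard basis \<open>b\<close>, the vectors \<open>(b, - f/2)\<close> have square
  \<open>1\<close>, the vectors \<open>(b, f/2)\<close> have square \<open>-1\<close>, and all other products vanish.\<close>

lemma has_signature_g0:
  fixes \<omega> :: "'a::euclidean_space \<Rightarrow> 'a \<Rightarrow> real"
  assumes \<omega>: "nondegenerate_skew_form \<omega>"
  shows "has_signature (g0 \<omega>) DIM('a) DIM('a)"
proof -
  have bil: "bilinear \<omega>" and skew: "\<And>x y. \<omega> x y = - \<omega> y x"
    using \<omega> unfolding nondegenerate_skew_form_def by blast+
  obtain f where f: "span (f ` Basis) = UNIV"
    "\<And>b c. b \<in> Basis \<Longrightarrow> c \<in> Basis \<Longrightarrow> \<omega> b (f c) = (if b = c then 1 else 0)"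
    using dual_basis[OF \<omega>] by blast
  have f': "\<omega> (f c) b = - (if b = c then 1 else 0)" if "b \<in> Basis" "c \<in> Basis" for b c
    using f(2)[OF that] skew[of "f c" b] by simp
  let ?d = "DIM('a)"
  obtain b where b: "bij_betw b {..<?d} (Basis :: 'a set)"
    using ex_bij_betw_nat_finite[OF finite_Basis] by (metis atLeast0LessThan)
  have bB: "b i \<in> Basis" if "i < ?d" for i using b that by (auto simp: bij_betw_def)
  have b_eq: "b i = b j \<longleftrightarrow> i = j" if "i < ?d" "j < ?d" for i j
    using b that by (auto simp: bij_betw_def inj_on_def)
  define e where "e i = (if i < ?d then (b i, - (1/2) *\<^sub>R f (b i))
    else (b (i - ?d), (1/2) *\<^sub>R f (b (i - ?d))))" for i
  have gram: "g0 \<omega> (e i) (e j) = (if i \<noteq> j then 0 else if i < ?d then 1 else - 1)"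
    if "i < ?d + ?d" "j < ?d + ?d" for i j
  proof -
    have [simp]: "b (i - ?d) \<in> Basis" "b (j - ?d) \<in> Basis"
      "i < ?d \<Longrightarrow> b i \<in> Basis" "j < ?d \<Longrightarrow> b j \<in> Basis"
      using that by (auto intro!: bB)
    have "i - ?d < ?d" "j - ?d < ?d" using that by auto
    then show ?thesis
      by (auto simp: e_def g0_def bilinear_lmul[OF bil] bilinear_rmul[OF bil]
          bilinear_lneg[OF bil] bilinear_rneg[OF bil] f(2) f' b_eq)
  qed
  let ?S = "span (e ` {..<?d + ?d})"
  have e1: "(b i, - (1/2) *\<^sub>R f (b i)) \<in> ?S" if "i < ?d" for i
  proof -
    have "e i \<in> ?S" using that by (intro span_base imageI) simp
    then show ?thesis using that by (simp add: e_def)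
  qed
  have e2: "(b i, (1/2) *\<^sub>R f (b i)) \<in> ?S" if "i < ?d" for i
  proof -
    have "e (i + ?d) \<in> ?S" using that by (intro span_base imageI) simp
    then show ?thesis by (simp add: e_def)
  qed
  have "(b i, 0) \<in> ?S" if "i < ?d" for i
    using span_scale[OF span_add[OF e1[OF that] e2[OF that]], of "1/2"]
    by (simp flip: scaleR_2)
  then have p1: "(c, 0) \<in> ?S" if "c \<in> Basis" for c
    using that b by (metis bij_betw_imp_surj_on imageE lessThan_iff)
  have "(0, f (b i)) \<in> ?S" if "i < ?d" for i
    using span_diff[OF e2[OF that] e1[OF that]] by (simp flip: scaleR_add_left)
  then have p2: "(0, f c) \<in> ?S" if "c \<in> Basis" for c
    using that b by (metis bij_betw_imp_surj_on imageE lessThan_iff)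
  have "(x, 0) \<in> ?S" for x
  proof -
    have "linear (\<lambda>a::'a. (a, 0) :: 'a \<times> 'a)"
      by (rule linearI) auto
    from linear_span_image[OF this, of Basis]
    have "(x, 0::'a) \<in> span ((\<lambda>a. (a, 0)) ` Basis)"
      by auto
    also have "\<dots> \<subseteq> ?S"
      using p1 by (intro span_minimal subspace_span) blast
    finally show ?thesis .
  qed
  moreover have "(0, y) \<in> ?S" for y
  proof -
    have "linear (\<lambda>a::'a. (0, a) :: 'a \<times> 'a)"
      by (rule linearI) auto
    from linear_span_image[OF this, of "f ` Basis"]
    have "(0::'a, y) \<in> span ((\<lambda>a. (0, a)) ` f ` Basis)"
      using f(1) by auto
    also have "\<dots> \<subseteq> ?S"
      using p2 by (intro span_minimal subspace_span) blast
    finally show ?thesis .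
  qed
  ultimately have "(x, y) \<in> ?S" for x y
    using span_add[of "(x, 0)" _ "(0, y)"] by (metis add_Pair add.right_neutral add.left_neutral)
  then have "?S = UNIV" by auto
  then show ?thesis
    unfolding has_signature_def using gram by (intro conjI exI[of _ e]) auto
qed


section \<open>Compatible pairs of affine structures\<close>

text \<open>Two affine structures, both compatible with the same form \<open>\<omega>\<close>, whose mixed products
  \<open>D x \<circ> D' y\<close> are symmetric in \<open>x\<close> and \<open>y\<close>.\<close>

locale affine_pair =
  fixes \<omega> :: "'a::euclidean_space \<Rightarrow> 'a \<Rightarrow> real" and D D' :: "'a \<Rightarrow> 'a \<Rightarrow> 'a"
  assumes form: "nondegenerate_skew_form \<omega>"
    and affine: "affine_structure D" "compatible \<omega> D"
    and affine': "affine_structure D'" "compatible \<omega> D'"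
    and mix: "\<forall>x y. D x \<circ> D' y = D y \<circ> D' x"
begin

abbreviation "G \<equiv> nil_group D D'"

lemma bil: "bilinear \<omega>" "bilinear D" "bilinear D'"
  using form affine affine' unfolding nondegenerate_skew_form_def affine_structure_def by auto

lemma bounded_bil: "bounded_bilinear \<omega>" "bounded_bilinear D" "bounded_bilinear D'"
  using bil by (simp_all add: bilinear_conv_bounded_bilinear)

lemmas bil_simps =
  bilinear_ladd[OF bil(1)] bilinear_radd[OF bil(1)] bilinear_lsub[OF bil(1)]
  bilinear_rsub[OF bil(1)] bilinear_lmul[OF bil(1)] bilinear_rmul[OF bil(1)]
  bilinear_lneg[OF bil(1)] bilinear_rneg[OF bil(1)] bilinear_lzero[OF bil(1)]
  bilinear_rzero[OF bil(1)]
  bilinear_ladd[OF bil(2)] bilinear_radd[OF bil(2)] bilinear_lsub[OF bil(2)]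
  bilinear_rsub[OF bil(2)] bilinear_lmul[OF bil(2)] bilinear_rmul[OF bil(2)]
  bilinear_lneg[OF bil(2)] bilinear_rneg[OF bil(2)] bilinear_lzero[OF bil(2)]
  bilinear_rzero[OF bil(2)]
  bilinear_ladd[OF bil(3)] bilinear_radd[OF bil(3)] bilinear_lsub[OF bil(3)]
  bilinear_rsub[OF bil(3)] bilinear_lmul[OF bil(3)] bilinear_rmul[OF bil(3)]
  bilinear_lneg[OF bil(3)] bilinear_rneg[OF bil(3)] bilinear_lzero[OF bil(3)]
  bilinear_rzero[OF bil(3)]

lemma skew: "\<omega> x y = - \<omega> y x"
  using form unfolding nondegenerate_skew_form_def by blast

lemma sym: "D x y = D y x" "D' x y = D' y x"
  using affine affine' unfolding affine_structure_def by auto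

lemma square_zero: "D x (D y z) = 0" "D' x (D' y z) = 0"
  using compatible_affine_square_zero form affine affine' by blast+

lemma swap: "D x (D' y z) = D y (D' x z)" "D' x (D y z) = D' y (D x z)"
  using mix mixed_swap[OF form affine(2) affine'(2)] by (metis comp_apply, blast)

lemma adj: "\<omega> (D x y) z = - \<omega> y (D x z)" "\<omega> (D' x y) z = - \<omega> y (D' x z)"
  using affine(2) affine'(2) skew unfolding compatible_def by metis+

lemma form_D_sym: "\<omega> (D x y) z = \<omega> (D x z) y" "\<omega> (D' x y) z = \<omega> (D' x z) y"
  using affine(2) affine'(2) unfolding compatible_def by auto

text \<open>The mixed products are symmetric in their three arguments, and moving them across
  \<open>\<omega>\<close> makes \<open>\<omega> (D x (D' y z)) w\<close> symmetric in all four.\<close>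

lemma form_mixed: "\<omega> (D x (D' y z)) w = - \<omega> (D' y (D x w)) z"
  by (simp add: adj skew[of z])

lemma form_mixed_sym: "\<omega> (D x (D' y z)) w = \<omega> (D x (D' y w)) z"
proof -
  have swap': "D a (D' y b) = D b (D' y a)" for a b
    using swap(1)[of a b y] by (simp add: sym)
  have "\<omega> (D x (D' y z)) w = - \<omega> (D' y (D z w)) x"
    by (simp add: swap'[of x z] form_mixed)
  also have "\<dots> = - \<omega> (D' y (D w z)) x"
    by (simp add: sym)
  also have "\<dots> = \<omega> (D x (D' y w)) z"
    by (simp add: swap'[of x w] form_mixed)
  finally show ?thesis .
qed

text \<open>Moving the product across \<open>\<omega>\<close> costs a sign, and the symmetry in all arguments
  restores the order.\<close>

lemma anticommute: "D' x (D y z) = - D y (D' x z)"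
proof -
  have "\<omega> (D' x (D y z) + D y (D' x z)) w = 0" for w
    using form_mixed[of y x w z] form_mixed_sym[of y x z w] by (simp add: bil_simps)
  then have "D' x (D y z) + D y (D' x z) = 0"
    using form unfolding nondegenerate_skew_form_def by blast
  then show ?thesis by (simp add: add_eq_0_iff2)
qed

lemma triple_zero: "D' x (D y (D' z w)) = 0"
  by (simp add: anticommute square_zero bil_simps)


section \<open>Left translations of the group\<close>

text \<open>The differential at the neutral element of the left translation by \<open>p\<close>, and its
  inverse.\<close>

definition left_diff :: "'a \<times> 'a \<Rightarrow> 'a \<times> 'a \<Rightarrow> 'a \<times> 'a" where
  "left_diff p v = (fst v + D' (snd p) (fst v),
     snd v - D (snd p) (fst v) - (1/2) *\<^sub>R D (snd p) (D' (snd p) (fst v)))"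

definition left_coframe :: "'a \<times> 'a \<Rightarrow> 'a \<times> 'a \<Rightarrow> 'a \<times> 'a" where
  "left_coframe p v = (fst v - D' (snd p) (fst v),
     snd v + D (snd p) (fst v) - (1/2) *\<^sub>R D (snd p) (D' (snd p) (fst v)))"

lemma left_diff_coframe: "left_diff p (left_coframe p v) = v"
  by (simp add: left_diff_def left_coframe_def prod_eq_iff bil_simps square_zero
      diff_eq_eq flip: scaleR_add_left)

lemma left_coframe_diff: "left_coframe p (left_diff p v) = v"
  by (simp add: left_diff_def left_coframe_def prod_eq_iff bil_simps square_zero
      diff_eq_eq flip: scaleR_add_left)

lemma linear_left_diff: "linear (left_diff p)"
  by (rule linearI) (simp_all add: left_diff_def bil_simps algebra_simps)

lemma linear_left_coframe: "linear (left_coframe p)"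
  by (rule linearI) (simp_all add: left_coframe_def bil_simps algebra_simps)

lemma inv_left_diff: "inv_into UNIV (left_diff p) = left_coframe p"
  by (rule inv_equality) (simp_all add: left_diff_coframe left_coframe_diff)

lemma has_derivative_left_mult:
  "(nil_mult D D' p has_derivative
     (\<lambda>v. (fst v + D' (fst v) (snd p)
             - (1/2) *\<^sub>R (D' (fst q) (D (fst v) (snd p)) + D' (fst v) (D (fst q) (snd p))),
           snd v - D (snd p) (fst v) - (1/2) *\<^sub>R D (snd p) (D' (snd p) (fst v))))) (at q)"
proof -
  have lin: "bounded_linear (D a)" "bounded_linear (\<lambda>x. D x a)"
    "bounded_linear (D' a)" "bounded_linear (\<lambda>x. D' x a)" for a
    using bounded_bil by (simp_all add: bounded_bilinear.bounded_linear_right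
        bounded_bilinear.bounded_linear_left)
  note [derivative_intros] = bounded_linear.has_derivative[OF lin(1)]
    bounded_linear.has_derivative[OF lin(2)] bounded_linear.has_derivative[OF lin(3)]
    bounded_linear.has_derivative[OF lin(4)] bounded_bilinear.FDERIV[OF bounded_bil(3)]
  have "nil_mult D D' p = (\<lambda>q.
      (fst p + fst q + D' (fst q) (snd p) - (1/2) *\<^sub>R D' (fst q) (D (fst q) (snd p)),
       snd p - D (snd p) (fst q) - (1/2) *\<^sub>R D (snd p) (D' (snd p) (fst q)) + snd q))"
    by (simp add: nil_mult_def fun_eq_iff split: prod.split)
  then show ?thesis
    by (simp only:) (rule has_derivative_eq_rhs, (rule derivative_intros)+,
      simp add: fun_eq_iff bil_simps algebra_simps)
qed

lemma mult_nil_group: "(\<lambda>r. p \<otimes>\<^bsub>G\<^esub> r) = nil_mult D D' p" "\<one>\<^bsub>G\<^esub> = 0"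
  by (simp_all add: nil_group_def zero_prod_def)

lemma has_derivative_d_left: "((\<lambda>r. p \<otimes>\<^bsub>G\<^esub> r) has_derivative d_left G p q) (at q)"
  unfolding d_left_def mult_nil_group
  using has_derivative_left_mult differentiableI frechet_derivative_works by blast

lemma d_left_one: "d_left G p \<one>\<^bsub>G\<^esub> = left_diff p"
proof -
  have "(nil_mult D D' p has_derivative left_diff p) (at 0)"
    using has_derivative_left_mult[of p 0] by (simp add: left_diff_def[abs_def] bil_simps sym)
  then show ?thesis
    unfolding d_left_def mult_nil_group by (metis frechet_derivative_at)
qed

text \<open>Left translation by \<open>p \<otimes> q\<close> is the composition of the translations by \<open>q\<close> and by \<open>p\<close>;
  this is the chain rule at the neutral element.\<close>

lemma d_left_left_diff: "d_left G p q (left_diff q v) = left_diff (p \<otimes>\<^bsub>G\<^esub> q) v"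
proof -
  interpret group G
    by (rule group_nil_group[OF form affine affine' mix])
  have carrier: "x \<in> carrier G" for x
    by (simp add: nil_group_def)
  have "((\<lambda>r. p \<otimes>\<^bsub>G\<^esub> (q \<otimes>\<^bsub>G\<^esub> r)) has_derivative
      (\<lambda>v. d_left G p (q \<otimes>\<^bsub>G\<^esub> \<one>\<^bsub>G\<^esub>) (d_left G q \<one>\<^bsub>G\<^esub> v))) (at \<one>\<^bsub>G\<^esub>)"
    by (rule has_derivative_compose[OF has_derivative_d_left has_derivative_d_left])
  then have "((\<lambda>r. (p \<otimes>\<^bsub>G\<^esub> q) \<otimes>\<^bsub>G\<^esub> r) has_derivative (\<lambda>v. d_left G p q (left_diff q v))) (at \<one>\<^bsub>G\<^esub>)"
    by (simp add: m_assoc carrier d_left_one)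
  from frechet_derivative_at[OF this] show ?thesis
    using d_left_one[of "p \<otimes>\<^bsub>G\<^esub> q"] unfolding d_left_def by metis
qed

lemma left_extend_endo_eq: "left_extend_endo G J p v = left_diff p (J (left_coframe p v))"
  by (simp add: left_extend_endo_def d_left_one inv_left_diff)

lemma left_extend_form_eq: "left_extend_form G g p u v = g (left_coframe p u) (left_coframe p v)"
  by (simp add: left_extend_form_def d_left_one inv_left_diff)

lemma left_coframe_d_left: "left_coframe (p \<otimes>\<^bsub>G\<^esub> q) (d_left G p q v) = left_coframe q v"
  using d_left_left_diff[of p q "left_coframe q v"] by (simp add: left_diff_coframe left_coframe_diff)

lemma left_invariant_left_extend:
  "left_invariant_endo G (left_extend_endo G J)" "left_invariant_form G (left_extend_form G g)"
  by (simp_all add: left_invariant_endo_def left_invariant_form_def left_extend_endo_eq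
      left_extend_form_eq left_coframe_d_left d_left_left_diff)

lemma smooth_left_coframe: "smooth_map (\<lambda>p. left_coframe p v)"
  unfolding left_coframe_def
  by (intro smooth_map_intros smooth_map_bilinear[OF bounded_bil(2)]
      smooth_map_bilinear[OF bounded_bil(3)])

lemma smooth_left_diff:
  assumes "smooth_map w"
  shows "smooth_map (\<lambda>p. left_diff p (w p))"
  unfolding left_diff_def
  by (intro smooth_map_intros smooth_map_bilinear[OF bounded_bil(2)]
      smooth_map_bilinear[OF bounded_bil(3)] assms
      smooth_map_compose_linear[OF bounded_linear_fst] smooth_map_compose_linear[OF bounded_linear_snd])

lemma tangent_endomorphism_left_extend:
  assumes "linear J"
  shows "tangent_endomorphism (left_extend_endo G J)"
proof -
  have "linear (left_diff p \<circ> (J \<circ> left_coframe p))" for p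
    by (intro linear_compose linear_left_diff linear_left_coframe assms)
  moreover have "smooth_map (\<lambda>p. left_diff p (J (left_coframe p v)))" for v
    using smooth_map_compose_linear[OF _ smooth_left_coframe] assms
    by (intro smooth_left_diff) (simp add: linear_conv_bounded_linear)
  ultimately show ?thesis
    unfolding tangent_endomorphism_def left_extend_endo_eq comp_def by blast
qed


section \<open>The hypersymplectic structure\<close>

lemma linear_J0: "linear (J0 :: 'a \<times> 'a \<Rightarrow> _)" and linear_E0: "linear (E0 :: 'a \<times> 'a \<Rightarrow> _)"
  by (auto intro!: linearI simp: J0_def E0_def)

lemma g0_symmetric: "g0 \<omega> u v = g0 \<omega> v u"
  using skew[of "snd u" "fst v"] skew[of "fst u" "snd v"] by (simp add: g0_def case_prod_beta)

lemma bilinear_g0: "bilinear (g0 \<omega>)"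
  unfolding bilinear_def linear_iff by (simp add: g0_def case_prod_beta bil_simps algebra_simps)

lemma pseudo_riemannian_metric_left_extend:
  "pseudo_riemannian_metric DIM('a) DIM('a) (left_extend_form G (g0 \<omega>))"
proof -
  have "bilinear (\<lambda>u v. g0 \<omega> (left_coframe p u) (left_coframe p v))" for p
    using bilinear_g0 linear_left_coframe[of p] unfolding bilinear_def linear_iff
    by (simp del: split_paired_All)
  moreover have "bounded_bilinear (g0 \<omega>)"
    using bilinear_g0 by (simp add: bilinear_conv_bounded_bilinear)
  then have "smooth_map (\<lambda>p. g0 \<omega> (left_coframe p u) (left_coframe p v))" for u v
    by (rule smooth_map_bilinear[OF _ smooth_left_coframe smooth_left_coframe])
  ultimately show ?thesis
    using g0_symmetric
      has_signature_linear_iso[OF has_signature_g0[OF form] linear_left_diff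
        left_diff_coframe left_coframe_diff]
    unfolding pseudo_riemannian_metric_def bilinear_field_def left_extend_form_eq by auto
qed

abbreviation "J \<equiv> left_extend_endo G J0"
abbreviation "E \<equiv> left_extend_endo G E0"
abbreviation "g \<equiv> left_extend_form G (g0 \<omega>)"

text \<open>The one-forms \<open>b \<mapsto> shear y a b\<close> on the second factor give the part of
  \<open>\<omega>\<close>, applied to second components of the coframe, that depends on the base point.
  The derivative in the direction \<open>t\<close> is symmetric in \<open>t\<close> and \<open>b\<close>.\<close>

definition shear :: "'a \<Rightarrow> 'a \<Rightarrow> 'a \<Rightarrow> real" where
  "shear y a b = \<omega> (D y a) b - (1/2) * \<omega> (D y (D' y a)) b"

text \<open>The derivative of \<open>shear\<close> in \<open>y\<close>. The two derivatives of the quadratic term are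
  equal, which cancels the factor \<open>1/2\<close>.\<close>

definition shear_deriv :: "'a \<Rightarrow> 'a \<Rightarrow> 'a \<Rightarrow> 'a \<Rightarrow> real" where
  "shear_deriv y t a b = \<omega> (D t a) b - \<omega> (D y (D' t a)) b"

text \<open>The values \<open>c = 1\<close> and \<open>c = -1\<close> give the first and the third fundamental form.\<close>

lemma closed_D:
  "closed_two_form (\<lambda>p u v. \<omega> (fst u) (fst v) + c * \<omega> (snd u) (snd v)
     + c * shear (snd p) (fst u) (snd v) - c * shear (snd p) (fst v) (snd u))"
proof (rule closed_two_form_mixed[where h' = "\<lambda>y t a b. c * shear_deriv y t a b"])
  show "bilinear (\<lambda>u v. \<omega> (fst u) (fst v) + c * \<omega> (snd u) (snd v))"
    unfolding bilinear_def linear_iff by (simp add: bil_simps algebra_simps)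
  show "\<omega> (fst u) (fst v) + c * \<omega> (snd u) (snd v)
      = - (\<omega> (fst v) (fst u) + c * \<omega> (snd v) (snd u))" for u v
    using skew[of "fst u" "fst v"] skew[of "snd u" "snd v"] by simp
  show "bilinear (\<lambda>a b. c * shear y a b)" for y
    unfolding bilinear_def linear_iff by (simp add: shear_def bil_simps algebra_simps)
  show "smooth_map (\<lambda>p. c * shear (snd p) a b)" for a b
    unfolding shear_def real_scaleR_def[symmetric]
    by (intro smooth_map_intros smooth_map_bilinear[OF bounded_bil(1)]
        smooth_map_bilinear[OF bounded_bil(2)] smooth_map_bilinear[OF bounded_bil(3)])
  have "((\<lambda>y. shear y a b) has_derivative (\<lambda>t. shear_deriv y t a b)) (at y)" for y a b
  proof -
    have \<omega>_left: "((\<lambda>y. \<omega> (f y) b) has_derivative (\<lambda>t. \<omega> (f' t) b)) (at y)"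
      if "(f has_derivative f') (at y)" for f f' :: "'a \<Rightarrow> 'a"
      by (rule bounded_linear.has_derivative[OF bounded_bilinear.bounded_linear_left[OF
            bounded_bil(1)] that])
    have D_left: "((\<lambda>y. D y a) has_derivative (\<lambda>t. D t a)) (at y)"
      and D'_left: "((\<lambda>y. D' y a) has_derivative (\<lambda>t. D' t a)) (at y)"
      using bounded_bil(2,3)[THEN bounded_bilinear.bounded_linear_left]
      by (simp_all add: bounded_linear_imp_has_derivative)
    have "((\<lambda>y. D y (D' y a)) has_derivative (\<lambda>t. D y (D' t a) + D t (D' y a))) (at y)"
      by (rule bounded_bilinear.FDERIV[OF bounded_bil(2) has_derivative_ident D'_left])
    then have "((\<lambda>y. D y (D' y a)) has_derivative (\<lambda>t. 2 *\<^sub>R D y (D' t a))) (at y)"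
      using swap(1)[of _ y a] by (simp add: scaleR_2)
    from has_derivative_diff[OF \<omega>_left[OF D_left]
        has_derivative_mult_right[OF \<omega>_left[OF this], of "1/2"]]
    show ?thesis
      by (simp add: shear_def shear_deriv_def bil_simps)
  qed
  then show "((\<lambda>y. c * shear y a b) has_derivative (\<lambda>t. c * shear_deriv y t a b)) (at y)" for y a b
    by (rule has_derivative_mult_right)
  show "c * shear_deriv y t a b = c * shear_deriv y b a t" for y t a b
    using form_D_sym(1)[of a t b] form_mixed_sym[of y a t b]
    by (simp add: shear_deriv_def sym)
qed

lemma closed_D':
  "closed_two_form (\<lambda>p u v. - \<omega> (fst u) (snd v) - \<omega> (snd u) (fst v)
     + \<omega> (D' (snd p) (fst u)) (snd v) - \<omega> (D' (snd p) (fst v)) (snd u))"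
proof (rule closed_two_form_mixed[where h' = "\<lambda>y t a b. \<omega> (D' t a) b"])
  show "bilinear (\<lambda>u v. - \<omega> (fst u) (snd v) - \<omega> (snd u) (fst v))"
    unfolding bilinear_def linear_iff by (simp add: bil_simps algebra_simps)
  show "- \<omega> (fst u) (snd v) - \<omega> (snd u) (fst v) = - (- \<omega> (fst v) (snd u) - \<omega> (snd v) (fst u))" for u v
    using skew[of "fst u" "snd v"] skew[of "snd u" "fst v"] by simp
  show "bilinear (\<lambda>a b. \<omega> (D' y a) b)" for y
    unfolding bilinear_def linear_iff by (simp add: bil_simps)
  show "smooth_map (\<lambda>p. \<omega> (D' (snd p) a) b)" for a b
    by (intro smooth_map_intros smooth_map_bilinear[OF bounded_bil(1)]
        smooth_map_bilinear[OF bounded_bil(3)])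
  show "((\<lambda>y. \<omega> (D' y a) b) has_derivative (\<lambda>t. \<omega> (D' t a) b)) (at y)" for y a b
    by (intro bounded_linear.has_derivative[OF bounded_bilinear.bounded_linear_left[OF bounded_bil(1)]]
        bounded_linear.has_derivative[OF bounded_bilinear.bounded_linear_left[OF bounded_bil(3)]]
        has_derivative_ident)
  show "\<omega> (D' t a) b = \<omega> (D' b a) t" for t a b
    using form_D_sym(2)[of a t b] by (simp add: sym)
qed

lemma form_rev: "\<omega> u (D y v) = - \<omega> (D y v) u" "\<omega> u (D' y v) = - \<omega> (D' y v) u"
  by (rule skew)+

lemma form_products:
  "\<omega> (D y a) (D y b) = 0" "\<omega> (D' y a) (D' y b) = 0"
  "\<omega> (D' y a) (D y b) = - \<omega> (D y (D' y a)) b"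
  "\<omega> (D y a) (D' y b) = \<omega> (D y (D' y a)) b"
  "\<omega> (D' y a) (D y (D' y b)) = 0" "\<omega> (D y (D' y a)) (D' y b) = 0"
proof -
  show DD': "\<omega> (D' y a) (D y b) = - \<omega> (D y (D' y a)) b" for a b
    using adj(1)[of y "D' y a" b] by simp
  show "\<omega> (D y a) (D y b) = 0" "\<omega> (D' y a) (D' y b) = 0"
    by (simp_all only: adj square_zero bil_simps minus_zero)
  show "\<omega> (D y a) (D' y b) = \<omega> (D y (D' y a)) b"
    using skew[of "D y a" "D' y b"] DD'[of b a] form_mixed_sym[of y y a b] by simp
  have zero: "\<omega> (D' y a) (D y (D' y b)) = 0" for a b
    by (simp add: adj(2) triple_zero bil_simps)
  show "\<omega> (D' y a) (D y (D' y b)) = 0"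
    by (rule zero)
  show "\<omega> (D y (D' y a)) (D' y b) = 0"
    using skew[of "D y (D' y a)" "D' y b"] zero[of b a] by linarith
qed

text \<open>The pairings under \<open>\<omega>\<close> of the components of the coframe. All terms of degree three
  and more in the base point vanish.\<close>

lemma coframe_fst:
  "\<omega> (fst (left_coframe p u)) (fst (left_coframe p v)) = \<omega> (fst u) (fst v)"
  using form_D_sym(2)[of "snd p" "fst u" "fst v"]
  by (simp add: left_coframe_def bil_simps form_products form_rev[of "fst u"])

lemma coframe_snd:
  "\<omega> (snd (left_coframe p u)) (snd (left_coframe p v))
    = \<omega> (snd u) (snd v) + shear (snd p) (fst u) (snd v) - shear (snd p) (fst v) (snd u)"
  by (simp add: left_coframe_def shear_def bil_simps form_products form_rev[of "fst u"]
      form_rev[of "snd u"] algebra_simps)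

lemma coframe_mixed:
  "- \<omega> (fst (left_coframe p u)) (snd (left_coframe p v))
    - \<omega> (snd (left_coframe p u)) (fst (left_coframe p v))
    = - \<omega> (fst u) (snd v) - \<omega> (snd u) (fst v)
      + \<omega> (D' (snd p) (fst u)) (snd v) - \<omega> (D' (snd p) (fst v)) (snd u)"
  using form_D_sym(1)[of "snd p" "fst u" "fst v"]
    form_D_sym(2)[of "snd p" "fst u" "fst v"]
    form_mixed_sym[of "snd p" "snd p" "fst u" "fst v"]
  by (simp add: left_coframe_def bil_simps form_products form_rev[of "fst u"]
      form_rev[of "snd u"] algebra_simps)

lemma closed_fundamental_forms:
  "closed_two_form (\<lambda>p u v. g p (J p u) v)"
  "closed_two_form (\<lambda>p u v. g p (E p u) v)"
  "closed_two_form (\<lambda>p u v. g p (J p (E p u)) v)"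
proof -
  have 1: "g p (J p u) v = \<omega> (fst u) (fst v) + 1 * \<omega> (snd u) (snd v)
      + 1 * shear (snd p) (fst u) (snd v) - 1 * shear (snd p) (fst v) (snd u)" for p u v
    using coframe_fst[of p u v] coframe_snd[of p u v]
    by (simp add: left_extend_form_eq left_extend_endo_eq left_coframe_diff g0_def J0_def
        case_prod_beta bil_simps)
  have 2: "g p (E p u) v = - \<omega> (fst u) (snd v) - \<omega> (snd u) (fst v)
     + \<omega> (D' (snd p) (fst u)) (snd v) - \<omega> (D' (snd p) (fst v)) (snd u)" for p u v
    using coframe_mixed[of p u v]
    by (simp add: left_extend_form_eq left_extend_endo_eq left_coframe_diff g0_def E0_def
        case_prod_beta bil_simps)
  have 3: "g p (J p (E p u)) v = \<omega> (fst u) (fst v) + (- 1) * \<omega> (snd u) (snd v)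
      + (- 1) * shear (snd p) (fst u) (snd v) - (- 1) * shear (snd p) (fst v) (snd u)" for p u v
    using coframe_fst[of p u v] coframe_snd[of p u v]
    by (simp add: left_extend_form_eq left_extend_endo_eq left_coframe_diff g0_def J0_def E0_def
        case_prod_beta bil_simps)
  show "closed_two_form (\<lambda>p u v. g p (J p u) v)"
    unfolding 1 by (rule closed_D)
  show "closed_two_form (\<lambda>p u v. g p (E p u) v)"
    unfolding 2 by (rule closed_D')
  show "closed_two_form (\<lambda>p u v. g p (J p (E p u)) v)"
    unfolding 3 by (rule closed_D)
qed

lemma para_hypercomplex_identities:
  "J p (J p v) = - v" "E p (E p v) = v" "J p (E p v) = - E p (J p v)"
  "g p (J p u) (J p v) = g p u v" "g p (E p u) (E p v) = - g p u v"
proof -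
  have "J0 (J0 w) = - w" "E0 (E0 w) = w" "J0 (E0 w) = - E0 (J0 w)" for w :: "'a \<times> 'a"
    by (simp_all add: J0_def E0_def case_prod_beta prod_eq_iff)
  then show "J p (J p v) = - v" "E p (E p v) = v" "J p (E p v) = - E p (J p v)"
    by (simp_all add: left_extend_endo_eq left_coframe_diff left_diff_coframe
        linear_neg[OF linear_left_diff])
  show "g p (J p u) (J p v) = g p u v"
    using skew[of "fst (left_coframe p v)" "snd (left_coframe p u)"]
      skew[of "snd (left_coframe p v)" "fst (left_coframe p u)"]
    by (simp add: left_extend_endo_eq left_extend_form_eq left_coframe_diff g0_def J0_def
        case_prod_beta bil_simps)
  show "g p (E p u) (E p v) = - g p u v"
    by (simp add: left_extend_endo_eq left_extend_form_eq left_coframe_diff g0_def E0_def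
        case_prod_beta bil_simps)
qed

end

theorem theorem4p1:
  fixes n :: nat
    and \<omega> :: "real ^ 'm::finite \<Rightarrow> real ^ 'm \<Rightarrow> real"
    and D D' :: "real ^ 'm \<Rightarrow> real ^ 'm \<Rightarrow> real ^ 'm"
  assumes "CARD('m) = 2 * n"
    and "nondegenerate_skew_form \<omega>"
    and "affine_structure D" and "compatible \<omega> D"
    and "affine_structure D'" and "compatible \<omega> D'"
    and "\<forall>x y. D x \<circ> D' y = D y \<circ> D' x"
  shows "left_invariant_hypersymplectic n (nil_group D D')
           (left_extend_endo (nil_group D D') J0)
           (left_extend_endo (nil_group D D') E0)
           (left_extend_form (nil_group D D') (g0 \<omega>))"
proof -
  interpret affine_pair \<omega> D D'
    by unfold_locales (fact assms)+
  have dim: "DIM(real ^ 'm) = 2 * n"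
    using assms(1) by simp
  show ?thesis
    unfolding left_invariant_hypersymplectic_def hypersymplectic_def
    using dim pseudo_riemannian_metric_left_extend[unfolded dim]
    by (intro conjI allI closed_fundamental_forms)
      (simp_all add: tangent_endomorphism_left_extend linear_J0 linear_E0
        para_hypercomplex_identities left_invariant_left_extend)
qed

end
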